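(* Let $P\in\mathbb{Z}[x]$ be a monic irreducible polynomial of degree $d$ with constant coefficient $a_0$. Let $n>1$ have prime factorisation $n=p_1^{k_1}\cdots p_l^{k_l}$ (with $l$ distinct primes) and put $n'=p_1^{k_1-1}\cdots p_l^{k_l-1}$. Then $U(n)$ is divisible by $$a_0^{\,n'\,2^{2(l-1)}\,d^{2^l-2}}.$$
   Context: Let $\alpha_1,\dots,\alpha_d$ be the roots of $P$. For $n>1$ let $\mathcal{D}_+(n)=\{m\mid n:\mu(n/m)=1\}$ and $\mathcal{D}_-(n)=\{m\mid n:\mu(n/m)=-1\}$ ($\mu$ the Möbius function); each has $r=2^{l-1}$ elements. For a multiset $\mathcal{N}=\{n_1,\dots,n_r\}$ of positive integers let $P_{\mathcal{N}}(x)=\prod_{j_1,\dots,j_r=1}^d(x-\alpha_{j_1}^{n_1}\cdots\alpha_{j_r}^{n_r})\in\mathbb{Z}[x]$. Then $U(n):=\operatorname{Res}(P_{\mathcal{D}_+(n)},P_{\mathcal{D}_-(n)})\in\mathbb{Z}$, where for monic $A,B$, $\operatorname{Res}(A,B)=\prod_{A(a)=0,B(b)=0}(a-b)$. Equivalently, $U(n)$ is the product, over all choices of indices $j_m\in\{1,\dots,d\}$ for each $m\in\mathcal{D}_+(n)\cup\mathcal{D}_-(n)$, of $\prod_{m\in\mathcal{D}_+(n)}\alpha_{j_m}^m-\prod_{m\in\mathcal{D}_-(n)}\alpha_{j_m}^m$. *)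

theory Defs
  imports
    "HOL-Computational_Algebra.Computational_Algebra"
    "HOL-Library.FuncSet"
begin

definition moebius :: "nat \<Rightarrow> int" where
  "moebius n = (if squarefree n then (-1) ^ card (prime_factors n) else 0)"

definition D_plus :: "nat \<Rightarrow> nat set" where
  "D_plus n = {m. m dvd n \<and> moebius (n div m) = 1}"

definition D_minus :: "nat \<Rightarrow> nat set" where
  "D_minus n = {m. m dvd n \<and> moebius (n div m) = -1}"

(* alpha 1, ..., alpha d enumerates the roots of P, and N = {n_1, ..., n_r} is listed in increasing
   order.  The functions j are the index tuples (j_1, ..., j_r); they are taken
   extensional so that every tuple occurs exactly once in the product. *)
definition root_prod_poly :: "(nat \<Rightarrow> complex) \<Rightarrow> nat \<Rightarrow> nat multiset \<Rightarrow> complex poly" where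
  "root_prod_poly \<alpha> d N =
     (let ns = sorted_list_of_multiset N; r = length ns
      in \<Prod>j \<in> {..<r} \<rightarrow>\<^sub>E {1..d}. [:- (\<Prod>i<r. \<alpha> (j i) ^ (ns ! i)), 1:])"

(* Resultant of monic polynomials; the roots are counted with multiplicity. *)
definition Res :: "complex poly \<Rightarrow> complex poly \<Rightarrow> complex" where
  "Res A B = (\<Prod>a\<in>#proots A. \<Prod>b\<in>#proots B. a - b)"

definition U :: "(nat \<Rightarrow> complex) \<Rightarrow> nat \<Rightarrow> nat \<Rightarrow> complex" where
  "U \<alpha> d n = Res (root_prod_poly \<alpha> d (mset_set (D_plus n)))
                 (root_prod_poly \<alpha> d (mset_set (D_minus n)))"

end

theory Submission
  imports "Jordan_Normal_Form.Char_Poly" Defs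
begin

text \<open>
  Let \<open>a\<^sub>t(j)\<close> and \<open>b\<^sub>t(k)\<close> be the exponents of the root \<open>\<alpha>\<^sub>t\<close> in the two monomials whose
  difference is the factor of \<open>U(n)\<close> with index tuples \<open>j\<close>, \<open>k\<close>. That factor is the product of
  \<open>\<alpha>\<^sub>t\<close> to the power \<open>min(a\<^sub>t(j), b\<^sub>t(k))\<close> over all \<open>t\<close>, times an algebraic integer. So if the sum of
  these minima over all \<open>j\<close>, \<open>k\<close> is at least \<open>E\<close> for every \<open>t\<close>, then \<open>U(n)\<close> is the \<open>E\<close>-th power of
  \<open>a\<^sub>0\<close> times an algebraic integer. The power sums of the factors of \<open>U(n)\<close> are polynomials in the
  power sums of the roots, so by Newton's identities \<open>U(n)\<close> is rational, and the cofactor is an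
  integer.

  With \<open>W\<close>, \<open>W'\<close> the sums of the elements of \<open>D\<^sub>+(n)\<close>, \<open>D\<^sub>-(n)\<close>, the bounds \<open>a\<^sub>t \<le> W\<close>, \<open>b\<^sub>t \<le> W'\<close> give
  \<open>min(a\<^sub>t, b\<^sub>t) max(W, W') \<ge> a\<^sub>t b\<^sub>t\<close>. Since \<open>a\<^sub>t\<close> and \<open>b\<^sub>t\<close> have means \<open>W/d\<close> and \<open>W'/d\<close>, one may take
  \<open>E\<close> to be \<open>min(W, W')\<close> times the power of \<open>d\<close> with exponent \<open>2r - 2\<close>. Finally \<open>W + W'\<close> and \<open>W - W'\<close>
  are \<open>n'\<close> times the products of \<open>p + 1\<close> and of \<open>p - 1\<close> over the primes dividing \<open>n\<close>; adding a prime
  \<open>p \<ge> 3\<close> at least quadruples the difference of these products, which bounds \<open>W'\<close> below by \<open>n' r\<^sup>2\<close>.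
\<close>

section \<open>Algebraic integers form a ring, shown with finitely generated modules over the
  integers\<close>

interpretation int_span: Modules.module "\<lambda>(k::int) (x::'a::field_char_0). of_int k * x"
  by standard (auto simp: algebra_simps)

text \<open>The determinant trick: an integer matrix \<open>M\<close> describes multiplication by
  \<open>q\<close> on the generators in \<open>B\<close>. The vector of generators is an eigenvector
  for the eigenvalue \<open>q\<close>, nonzero because 1 is among its entries. So \<open>q\<close>
  is a root of the monic integer polynomial \<open>char_poly M\<close>.\<close>

lemma algebraic_int_if_stabilises_span:
  fixes B :: "'a::field_char_0 set" and q :: 'a
  assumes "finite B" and one: "1 \<in> B"
    and stab: "\<And>b. b \<in> B \<Longrightarrow> q * b \<in> int_span.span B"
  shows "algebraic_int q"
proof -
  define n where "n = card B"
  obtain h where h: "bij_betw h {..<n} B"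
    using ex_bij_betw_nat_finite[OF \<open>finite B\<close>] by (auto simp: n_def atLeast0LessThan)
  have "\<exists>u. q * b = (\<Sum>v\<in>B. of_int (u v) * v)" if "b \<in> B" for b
    using stab[OF that] unfolding int_span.span_finite[OF \<open>finite B\<close>] by auto
  then obtain u where u: "\<And>b. b \<in> B \<Longrightarrow> q * b = (\<Sum>v\<in>B. of_int (u b v) * v)"
    by metis
  define M :: "int mat" where "M = mat n n (\<lambda>(i, j). u (h i) (h j))"
  define A :: "'a mat" where "A = map_mat of_int M"
  define v :: "'a vec" where "v = vec n h"
  have M: "M \<in> carrier_mat n n" and A: "A \<in> carrier_mat n n" and v: "v \<in> carrier_vec n"
    by (auto simp: M_def A_def v_def)
  have "A *\<^sub>v v = q \<cdot>\<^sub>v v"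
  proof (rule eq_vecI)
    fix i assume "i < dim_vec (q \<cdot>\<^sub>v v)"
    then have i: "i < n" by (simp add: v_def)
    then have hi: "h i \<in> B" using h by (auto simp: bij_betw_def)
    have "(A *\<^sub>v v) $ i = (\<Sum>j<n. of_int (u (h i) (h j)) * h j)"
      using i by (auto simp: A_def M_def v_def scalar_prod_def atLeast0LessThan)
    also have "\<dots> = q * h i"
      unfolding u[OF hi] by (rule sum.reindex_bij_betw[OF h])
    finally show "(A *\<^sub>v v) $ i = (q \<cdot>\<^sub>v v) $ i"
      using i by (simp add: v_def)
  qed (simp add: A_def M_def v_def)
  moreover have "v \<noteq> 0\<^sub>v n"
  proof
    assume v0: "v = 0\<^sub>v n"
    obtain i where "i < n" "h i = 1"
      using h one unfolding bij_betw_def by (metis imageE lessThan_iff)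
    then show False using arg_cong[OF v0, of "\<lambda>w. vec_index w i"] by (simp add: v_def)
  qed
  ultimately have "eigenvalue A q"
    using A v unfolding eigenvalue_def eigenvector_def by auto
  then have "poly (char_poly A) q = 0"
    using eigenvalue_root_char_poly[OF A] by simp
  moreover have "char_poly A = map_poly of_int (char_poly M)"
    unfolding A_def by (rule of_int_hom.char_poly_hom[OF M])
  moreover have "lead_coeff (char_poly M) = 1"
    using degree_monic_char_poly[OF M] by simp
  ultimately show ?thesis
    unfolding algebraic_int_altdef_ipoly by auto
qed

text \<open>A monic equation for \<open>x\<close> is solved for its leading term; \<open>a\<close>
  is its degree, which is positive because the constant polynomial 1 has no root.\<close>

lemma algebraic_int_power_in_span:
  fixes x :: "'a::field_char_0"
  assumes "algebraic_int x"
  shows "\<exists>a>0. x ^ a \<in> int_span.span ((\<lambda>i. x ^ i) ` {..<a})"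
proof -
  obtain p where p: "poly (map_poly of_int p) x = 0" "lead_coeff p = 1"
    using assms unfolding algebraic_int_altdef_ipoly by blast
  define a where "a = degree p"
  have "a > 0"
  proof (rule ccontr)
    assume "\<not> a > 0"
    then have "p = [:1:]" using p(2) by (metis a_def degree_eq_zeroE gr0I lead_coeff_pCons(2))
    then show False using p(1) by simp
  qed
  have deg: "degree (map_poly of_int p :: 'a poly) = a"
    by (simp add: a_def)
  have "0 = (\<Sum>i\<le>a. of_int (coeff p i) * x ^ i)"
    using p(1) by (simp add: poly_altdef a_def)
  also have "\<dots> = x ^ a + (\<Sum>i<a. of_int (coeff p i) * x ^ i)"
    using p(2) by (simp add: lessThan_Suc_atMost[symmetric] a_def add.commute)
  finally have "x ^ a = - (\<Sum>i<a. of_int (coeff p i) * x ^ i)"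
    by (simp add: eq_neg_iff_add_eq_0)
  moreover have "- (\<Sum>i<a. of_int (coeff p i) * x ^ i) \<in> int_span.span ((\<lambda>i. x ^ i) ` {..<a})"
    by (intro int_span.span_neg int_span.span_sum int_span.span_scale int_span.span_base) auto
  ultimately show ?thesis using \<open>a > 0\<close> by metis
qed

lemma int_span_mult_closed:
  fixes B :: "'a::field_char_0 set"
  assumes "\<And>b. b \<in> B \<Longrightarrow> x * b \<in> int_span.span C" and "y \<in> int_span.span B"
  shows "x * y \<in> int_span.span C"
  using assms(2)
proof (induction rule: int_span.span_induct_alt)
  case base
  then show ?case using int_span.span_zero by simp
next
  case (step c b y)
  then have "of_int c * (x * b) + x * y \<in> int_span.span C"
    by (blast intro: int_span.span_add int_span.span_scale assms(1))
  then show ?case by (simp add: algebra_simps)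
qed

text \<open>The products \<open>x ^ i * y ^ j\<close> with \<open>i < a\<close> and
  \<open>j < b\<close> span a module stable under multiplication by \<open>x\<close> and by
  \<open>y\<close>: an exponent that reaches its bound is reduced by the relation for
  \<open>x ^ a\<close> or \<open>y ^ b\<close>. Hence \<open>x + y\<close> and \<open>x * y\<close>
  stabilise it too.\<close>

lemma
  fixes x y :: "'a::field_char_0"
  assumes "algebraic_int x" and "algebraic_int y"
  shows algebraic_int_add: "algebraic_int (x + y)"
    and algebraic_int_mult: "algebraic_int (x * y)"
proof -
  obtain a b where "a > 0" "b > 0"
    and a: "x ^ a \<in> int_span.span ((\<lambda>i. x ^ i) ` {..<a})"
    and b: "y ^ b \<in> int_span.span ((\<lambda>i. y ^ i) ` {..<b})"
    using algebraic_int_power_in_span assms by metis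
  define B where "B = (\<lambda>(i, j). x ^ i * y ^ j) ` ({..<a} \<times> {..<b})"
  have BI: "x ^ i * y ^ j \<in> int_span.span B" if "i < a" "j < b" for i j
    unfolding B_def using that by (intro int_span.span_base) auto
  have xB: "x * c \<in> int_span.span B" if "c \<in> B" for c
  proof -
    from that obtain i j where ij: "i < a" "j < b" "c = x ^ i * y ^ j"
      by (auto simp: B_def)
    show ?thesis
    proof (cases "Suc i < a")
      case True
      then show ?thesis using BI[OF True ij(2)] by (simp add: ij mult_ac)
    next
      case False
      then have "Suc i = a" using ij by simp
      moreover have "y ^ j * x ^ a \<in> int_span.span B"
        by (rule int_span_mult_closed[OF _ a]) (use ij BI in \<open>auto simp: mult.commute\<close>)
      ultimately show ?thesis by (auto simp: ij mult_ac)
    qed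
  qed
  have yB: "y * c \<in> int_span.span B" if "c \<in> B" for c
  proof -
    from that obtain i j where ij: "i < a" "j < b" "c = x ^ i * y ^ j"
      by (auto simp: B_def)
    show ?thesis
    proof (cases "Suc j < b")
      case True
      then show ?thesis using BI[OF ij(1) True] by (simp add: ij mult_ac)
    next
      case False
      then have "Suc j = b" using ij by simp
      moreover have "x ^ i * y ^ b \<in> int_span.span B"
        by (rule int_span_mult_closed[OF _ b]) (use ij BI in auto)
      ultimately show ?thesis by (auto simp: ij mult_ac)
    qed
  qed
  have B: "finite B" "1 \<in> B"
    using \<open>a > 0\<close> \<open>b > 0\<close> by (auto simp: B_def intro!: image_eqI[of _ _ "(0, 0)"])
  show "algebraic_int (x + y)"
    by (rule algebraic_int_if_stabilises_span[OF B])
       (auto simp: distrib_right intro!: int_span.span_add xB yB)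
  show "algebraic_int (x * y)"
  proof (rule algebraic_int_if_stabilises_span[OF B])
    fix c assume "c \<in> B"
    have "x * (y * c) \<in> int_span.span B"
      by (rule int_span_mult_closed[OF xB yB[OF \<open>c \<in> B\<close>]])
    then show "x * y * c \<in> int_span.span B" by (simp add: mult.assoc)
  qed
qed

lemma algebraic_int_prod:
  fixes f :: "'b \<Rightarrow> 'a::field_char_0"
  assumes "\<And>x. x \<in> A \<Longrightarrow> algebraic_int (f x)"
  shows "algebraic_int (\<Prod>x\<in>A. f x)"
  using assms by (induction A rule: infinite_finite_induct) (auto intro: algebraic_int_mult)

lemma algebraic_int_power:
  fixes x :: "'a::field_char_0"
  assumes "algebraic_int x"
  shows "algebraic_int (x ^ k)"
  using assms by (induction k) (auto intro: algebraic_int_mult)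

lemma algebraic_int_diff:
  fixes x y :: "'a::field_char_0"
  assumes "algebraic_int x" and "algebraic_int y"
  shows "algebraic_int (x - y)"
  using algebraic_int_add[of x "- y"] assms by simp

section \<open>Newton's identities and their arithmetic consequences\<close>

text \<open>This is the logarithmic derivative of the product, cleared of denominators. In the
  induction, the new factor \<open>L\<close> contributes the geometric series
  \<open>G\<close>.\<close>

lemma newton_identity_fps:
  fixes y :: "'b \<Rightarrow> 'a::field"
  assumes "finite T"
  shows "fps_X * fps_deriv (fps_of_poly (\<Prod>t\<in>T. [:1, - y t:])) =
    - fps_of_poly (\<Prod>t\<in>T. [:1, - y t:]) * Abs_fps (\<lambda>k. if k = 0 then 0 else \<Sum>t\<in>T. y t ^ k)"
  using assms
proof (induction T)
  case empty
  show ?case by (simp add: fps_eq_iff)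
next
  case (insert s T)
  define E where "E = fps_of_poly (\<Prod>t\<in>T. [:1, - y t:])"
  define L where "L = fps_of_poly [:1, - y s:]"
  define S where "S = Abs_fps (\<lambda>k. if k = 0 then 0 else \<Sum>t\<in>T. y t ^ k)"
  define G where "G = Abs_fps (\<lambda>k. if k = 0 then 0 else y s ^ k)"
  have L: "L = 1 - fps_const (y s) * fps_X"
    unfolding L_def by (simp add: fps_of_poly_pCons)
  have geo: "L * G = fps_const (y s) * fps_X"
  proof (rule fps_ext)
    fix k
    show "fps_nth (L * G) k = fps_nth (fps_const (y s) * fps_X) k"
      unfolding L G_def
      by (cases k) (auto simp: left_diff_distrib mult.assoc fps_X_nth)
  qed
  have IH: "fps_X * fps_deriv E = - E * S"
    using insert.IH by (simp add: E_def S_def)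
  have "fps_X * fps_deriv (L * E) = L * (fps_X * fps_deriv E) - fps_const (y s) * fps_X * E"
    by (simp add: L algebra_simps)
  also have "\<dots> = - (L * E) * S - (L * G) * E"
    unfolding IH geo by (simp add: mult_ac)
  also have "\<dots> = - (L * E) * (S + G)"
    by (simp add: algebra_simps)
  also have "S + G = Abs_fps (\<lambda>k. if k = 0 then 0 else \<Sum>t\<in>insert s T. y t ^ k)"
    using insert.hyps by (auto simp: S_def G_def fps_eq_iff add.commute)
  also have "L * E = fps_of_poly (\<Prod>t\<in>insert s T. [:1, - y t:])"
    using insert.hyps by (simp add: L_def E_def fps_of_poly_mult)
  finally show ?case .
qed

text \<open>Coefficients of degree \<open>k\<close> are compared in the power series identity. The
  series of power sums has constant term 0, so the summand \<open>i = k\<close> drops out.\<close>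

lemma newton_identity:
  fixes y :: "'b \<Rightarrow> 'a::field"
  assumes "finite T" and "k > 0"
  defines "Q \<equiv> \<Prod>t\<in>T. [:1, - y t:]"
  shows "of_nat k * coeff Q k = - (\<Sum>i<k. coeff Q i * (\<Sum>t\<in>T. y t ^ (k - i)))"
proof -
  let ?S = "Abs_fps (\<lambda>k. if k = 0 then 0 else \<Sum>t\<in>T. y t ^ k)"
  have "of_nat k * coeff Q k = fps_nth (fps_X * fps_deriv (fps_of_poly Q)) k"
    using \<open>k > 0\<close> by (cases k) auto
  also have "\<dots> = - fps_nth (fps_of_poly Q * ?S) k"
    unfolding Q_def newton_identity_fps[OF assms(1)] by simp
  also have "fps_nth (fps_of_poly Q * ?S) k = (\<Sum>i\<le>k. coeff Q i * fps_nth ?S (k - i))"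
    by (simp add: fps_mult_nth atLeast0AtMost)
  also have "\<dots> = (\<Sum>i<k. coeff Q i * (\<Sum>t\<in>T. y t ^ (k - i)))"
    by (simp add: lessThan_Suc_atMost[symmetric])
  finally show ?thesis .
qed

lemma coeff_0_prod_reversed: "coeff (\<Prod>t\<in>T. [:1, - y t:] :: 'a::field poly) 0 = 1"
  by (simp add: poly_0_coeff_0[symmetric] poly_prod)

lemma reflect_prod_linear:
  fixes y :: "'b \<Rightarrow> 'a::field"
  shows "reflect_poly (\<Prod>t\<in>T. [:- y t, 1:]) = (\<Prod>t\<in>T. [:1, - y t:])"
proof -
  have "reflect_poly [:- y t, 1:] = [:1, - y t:]" for t
    by (simp add: reflect_poly_def)
  then show ?thesis by (simp add: reflect_poly_prod)
qed

text \<open>Newton's identity is solved for the \<open>k\<close>-th power sum, which has the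
  coefficient \<open>coeff Q 0 = 1\<close>; no division occurs, so integrality survives the
  induction.\<close>

lemma power_sum_in_Ints:
  fixes y :: "'b \<Rightarrow> 'a::field_char_0"
  assumes "finite T" and coeffs: "\<And>k. coeff (\<Prod>t\<in>T. [:- y t, 1:]) k \<in> \<int>"
  shows "(\<Sum>t\<in>T. y t ^ k) \<in> \<int>"
proof (induction k rule: less_induct)
  case (less k)
  define Q where "Q = (\<Prod>t\<in>T. [:1, - y t:])"
  have Q: "coeff Q i \<in> \<int>" for i
    unfolding Q_def reflect_prod_linear[symmetric] coeff_reflect_poly using coeffs by auto
  show ?case
  proof (cases k)
    case (Suc m)
    have "{..<k} = insert 0 {1..<k}"
      using Suc by auto
    then have "of_nat k * coeff Q k =
        - (\<Sum>i\<in>insert 0 {1..<k}. coeff Q i * (\<Sum>t\<in>T. y t ^ (k - i)))"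
      using newton_identity[OF assms(1), of k y] Suc by (simp add: Q_def)
    then have "of_nat k * coeff Q k =
        - ((\<Sum>t\<in>T. y t ^ k) + (\<Sum>i\<in>{1..<k}. coeff Q i * (\<Sum>t\<in>T. y t ^ (k - i))))"
      using coeff_0_prod_reversed[of y T] by (simp add: Q_def)
    then have "(\<Sum>t\<in>T. y t ^ k) =
        - of_nat k * coeff Q k - (\<Sum>i\<in>{1..<k}. coeff Q i * (\<Sum>t\<in>T. y t ^ (k - i)))"
      by simp
    also have "\<dots> \<in> \<int>"
    proof -
      have "coeff Q i * (\<Sum>t\<in>T. y t ^ (k - i)) \<in> \<int>" if "i \<in> {1..<k}" for i
        using Q less[of "k - i"] that by (intro Ints_mult) auto
      then show ?thesis
        by (intro Ints_diff Ints_sum Ints_mult[OF Ints_minus[OF Ints_of_nat] Q])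
    qed
    finally show ?thesis .
  qed simp
qed

text \<open>Now Newton's identity is solved for \<open>coeff Q k\<close>. This divides by
  \<open>k\<close>, so it yields rational numbers only.\<close>

lemma prod_in_Rats_if_power_sums_in_Rats:
  fixes y :: "'b \<Rightarrow> 'a::field_char_0"
  assumes "finite T" and sums: "\<And>k. k > 0 \<Longrightarrow> (\<Sum>t\<in>T. y t ^ k) \<in> \<rat>"
  shows "(\<Prod>t\<in>T. y t) \<in> \<rat>"
proof -
  define Q where "Q = (\<Prod>t\<in>T. [:1, - y t:])"
  have Q: "coeff Q k \<in> \<rat>" for k
  proof (induction k rule: less_induct)
    case (less k)
    show ?case
    proof (cases "k = 0")
      case True
      then show ?thesis by (simp add: Q_def coeff_0_prod_reversed)
    next
      case False
      then have "coeff Q k = - (\<Sum>i<k. coeff Q i * (\<Sum>t\<in>T. y t ^ (k - i))) / of_nat k"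
        using newton_identity[OF assms(1), of k y] by (simp add: Q_def field_simps)
      also have "\<dots> \<in> \<rat>"
      proof -
        have "coeff Q i * (\<Sum>t\<in>T. y t ^ (k - i)) \<in> \<rat>" if "i < k" for i
          using less[OF that] sums[of "k - i"] that by (intro Rats_mult) auto
        then show ?thesis
          by (intro Rats_divide Rats_minus_iff[THEN iffD2] Rats_sum) auto
      qed
      finally show ?thesis .
    qed
  qed
  let ?P = "\<Prod>t\<in>T. [:- y t, 1:]"
  \<comment> \<open>The index is the degree of \<open>?P\<close> and not of \<open>Q\<close>: a zero
    among the \<open>y t\<close> lowers the degree of \<open>Q\<close>, and both sides are then
    0.\<close>
  have "coeff Q (degree ?P) = coeff ?P 0"
    unfolding Q_def reflect_prod_linear[symmetric] by (simp add: coeff_reflect_poly)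
  also have "\<dots> = (-1) ^ card T * (\<Prod>t\<in>T. y t)"
    by (simp add: poly_0_coeff_0[symmetric] poly_prod prod_uminus)
  finally have "(\<Prod>t\<in>T. y t) = (-1) ^ card T * coeff Q (degree ?P)"
    by (simp add: power_mult_distrib[symmetric] mult.assoc[symmetric])
  also have "\<dots> \<in> \<rat>"
    using Q by (intro Rats_mult Rats_power) auto
  finally show ?thesis .
qed

section \<open>Exponents and power sums of monomials indexed by tuples\<close>

lemma card_PiE_fixed_value:
  assumes "finite I" and "i \<in> I" and "t \<in> S"
  shows "card {j \<in> I \<rightarrow>\<^sub>E S. j i = t} = card S ^ (card I - 1)"
proof -
  have "{j \<in> I \<rightarrow>\<^sub>E S. j i = t} = (\<Pi>\<^sub>E k\<in>I. if k = i then {t} else S)"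
    using assms by (auto simp: PiE_iff extensional_def split: if_splits)
  also have "card \<dots> = (\<Prod>k\<in>I. card (if k = i then {t} else S))"
    using assms by (intro card_PiE)
  also have "\<dots> = (\<Prod>k\<in>I - {i}. card S)"
    using assms by (subst prod.remove[of _ i]) (auto intro!: prod.cong)
  finally show ?thesis using assms by simp
qed

text \<open>Double counting: position \<open>i\<close> contributes \<open>w i\<close> once for every
  tuple with the value \<open>t\<close> there. With exponents as weights, the sum is the total
  exponent of one root over all monomials.\<close>

lemma sum_fibre_weights:
  fixes w :: "'b \<Rightarrow> nat"
  assumes "finite I" and "finite S" and "t \<in> S"
  shows "(\<Sum>j\<in>I \<rightarrow>\<^sub>E S. \<Sum>i\<in>{i\<in>I. j i = t}. w i) = (\<Sum>i\<in>I. w i) * card S ^ (card I - 1)"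
proof -
  have fin: "finite (I \<rightarrow>\<^sub>E S)"
    using assms by (simp add: finite_PiE)
  have "(\<Sum>j\<in>I \<rightarrow>\<^sub>E S. \<Sum>i\<in>{i\<in>I. j i = t}. w i) = (\<Sum>i\<in>I. \<Sum>j\<in>{j\<in>I \<rightarrow>\<^sub>E S. j i = t}. w i)"
    by (rule sum.swap_restrict[OF fin assms(1)])
  also have "\<dots> = (\<Sum>i\<in>I. w i * card S ^ (card I - 1))"
    using assms by (intro sum.cong) (simp_all add: card_PiE_fixed_value)
  finally show ?thesis by (simp add: sum_distrib_right)
qed

lemma sum_min_ge:
  fixes f :: "'b \<Rightarrow> nat" and g :: "'c \<Rightarrow> nat"
  assumes f: "\<And>j. j \<in> J \<Longrightarrow> f j \<le> W" "(\<Sum>j\<in>J. f j) = W * x"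
    and g: "\<And>k. k \<in> K \<Longrightarrow> g k \<le> W'" "(\<Sum>k\<in>K. g k) = W' * y"
  shows "min W W' * (x * y) \<le> (\<Sum>j\<in>J. \<Sum>k\<in>K. min (f j) (g k))"
proof (cases "max W W' = 0")
  case False
  \<comment> \<open>the larger of \<open>f j\<close>, \<open>g k\<close> is at most \<open>max W W'\<close>; this makes the double sum factorise\<close>
  have *: "f j * g k \<le> max W W' * min (f j) (g k)" if "j \<in> J" "k \<in> K" for j k
  proof (cases "f j \<le> g k")
    case True
    have "g k \<le> max W W'" using g(1)[OF that(2)] by simp
    then show ?thesis using True by (simp add: mult.commute[of "f j"] mult_right_mono)
  next
    case False
    have "f j \<le> max W W'" using f(1)[OF that(1)] by simp
    then show ?thesis using False by (simp add: min_def)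
  qed
  have "max W W' * (min W W' * (x * y)) = W * W' * (x * y)"
    by (simp add: max_def min_def)
  also have "\<dots> = (\<Sum>j\<in>J. f j) * (\<Sum>k\<in>K. g k)"
    by (simp add: f g mult_ac)
  also have "\<dots> = (\<Sum>j\<in>J. \<Sum>k\<in>K. f j * g k)"
    by (rule sum_product)
  also have "\<dots> \<le> (\<Sum>j\<in>J. \<Sum>k\<in>K. max W W' * min (f j) (g k))"
    by (intro sum_mono *)
  also have "\<dots> = max W W' * (\<Sum>j\<in>J. \<Sum>k\<in>K. min (f j) (g k))"
    by (simp add: sum_distrib_left)
  finally show ?thesis using False by (simp only: mult_le_cancel1)
qed simp

text \<open>Grouping positions by the root they select exposes the exponent of each root, so that
  two monomials can be compared root by root.\<close>

lemma prod_power_fibres: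
  fixes \<alpha> :: "'b \<Rightarrow> 'a::comm_monoid_mult"
  assumes "finite I" and "finite S" and "\<And>i. i \<in> I \<Longrightarrow> j i \<in> S"
  shows "(\<Prod>i\<in>I. \<alpha> (j i) ^ w i) = (\<Prod>t\<in>S. \<alpha> t ^ (\<Sum>i\<in>{i\<in>I. j i = t}. w i))"
proof -
  have "(\<Prod>t\<in>S. \<alpha> t ^ (\<Sum>i\<in>{i\<in>I. j i = t}. w i)) =
      (\<Prod>t\<in>S. \<Prod>i\<in>{i\<in>I. j i = t}. \<alpha> (j i) ^ w i)"
    unfolding power_sum by (intro prod.cong) auto
  also have "\<dots> = (\<Prod>i\<in>I. \<alpha> (j i) ^ w i)"
    using assms by (intro prod.group) auto
  finally show ?thesis ..
qed

text \<open>The binomial theorem turns the double sum into an integer combination of products of a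
  power sum of \<open>a\<close> and a power sum of \<open>b\<close>.\<close>

lemma sum_powers_of_differences_in_Ints:
  fixes a :: "'b \<Rightarrow> 'a::field_char_0" and b :: "'c \<Rightarrow> 'a"
  assumes "\<And>m. (\<Sum>j\<in>J. a j ^ m) \<in> \<int>" and "\<And>m. (\<Sum>k\<in>K. b k ^ m) \<in> \<int>"
  shows "(\<Sum>j\<in>J. \<Sum>k\<in>K. (a j - b k) ^ m) \<in> \<int>"
proof -
  have "(\<Sum>j\<in>J. \<Sum>k\<in>K. (a j - b k) ^ m) =
      (\<Sum>j\<in>J. \<Sum>k\<in>K. \<Sum>i\<le>m. of_nat (m choose i) * a j ^ i * ((-1) ^ (m - i) * b k ^ (m - i)))"
    unfolding diff_conv_add_uminus binomial_ring by (simp add: power_minus[of "b _"])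
  also have "\<dots> = (\<Sum>j\<in>J. \<Sum>i\<le>m. \<Sum>k\<in>K.
      of_nat (m choose i) * a j ^ i * ((-1) ^ (m - i) * b k ^ (m - i)))"
    by (intro sum.cong refl sum.swap)
  also have "\<dots> = (\<Sum>i\<le>m. \<Sum>j\<in>J. \<Sum>k\<in>K.
      of_nat (m choose i) * a j ^ i * ((-1) ^ (m - i) * b k ^ (m - i)))"
    by (rule sum.swap)
  also have "\<dots> = (\<Sum>i\<le>m. of_nat (m choose i) * (-1) ^ (m - i) *
      ((\<Sum>j\<in>J. a j ^ i) * (\<Sum>k\<in>K. b k ^ (m - i))))"
    unfolding sum_product by (simp add: sum_distrib_left mult_ac)
  also have "\<dots> \<in> \<int>"
  proof (rule Ints_sum)
    fix i
    show "of_nat (m choose i) * (-1) ^ (m - i) *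
        ((\<Sum>j\<in>J. a j ^ i) * (\<Sum>k\<in>K. b k ^ (m - i))) \<in> (\<int> :: 'a set)"
      by (intro Ints_mult Ints_power assms) auto
  qed
  finally show ?thesis .
qed

section \<open>Divisibility of a product of differences of monomials\<close>

text \<open>Arbitrary weights \<open>w\<close>, \<open>w'\<close> stand in for the divisors of
  \<open>n\<close>. The cofactor \<open>V\<close> is an algebraic integer by its explicit form, and
  for nonzero \<open>coeff P 0 ^ E\<close> it inherits rationality from the whole product.\<close>

lemma prod_differences_dvd:
  fixes \<alpha> :: "'b \<Rightarrow> complex" and w :: "'c \<Rightarrow> nat" and w' :: "'d \<Rightarrow> nat"
  assumes fin: "finite S" "finite I" "finite J"
    and P: "map_poly of_int P = (\<Prod>t\<in>S. [:- \<alpha> t, 1:])"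
    and E: "\<And>t. t \<in> S \<Longrightarrow> E \<le> (\<Sum>j\<in>I \<rightarrow>\<^sub>E S. \<Sum>k\<in>J \<rightarrow>\<^sub>E S.
      min (\<Sum>i\<in>{i\<in>I. j i = t}. w i) (\<Sum>i\<in>{i\<in>J. k i = t}. w' i))"
  shows "\<exists>u::int. (\<Prod>j\<in>I \<rightarrow>\<^sub>E S. \<Prod>k\<in>J \<rightarrow>\<^sub>E S.
      (\<Prod>i\<in>I. \<alpha> (j i) ^ w i) - (\<Prod>i\<in>J. \<alpha> (k i) ^ w' i)) = of_int u \<and> coeff P 0 ^ E dvd u"
proof -
  define a where "a j t = (\<Sum>i\<in>{i\<in>I. j i = t}. w i)" for j :: "'c \<Rightarrow> 'b" and t
  define b where "b k t = (\<Sum>i\<in>{i\<in>J. k i = t}. w' i)" for k :: "'d \<Rightarrow> 'b" and t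
  define A where "A j = (\<Prod>i\<in>I. \<alpha> (j i) ^ w i)" for j
  define B where "B k = (\<Prod>i\<in>J. \<alpha> (k i) ^ w' i)" for k
  define M where "M j k t = min (a j t) (b k t)" for j k t
  \<comment> \<open>What remains of \<open>A j - B k\<close> when the common power of every root is
    taken out; the subtractions in the exponents are exact because \<open>M j k t\<close> is a
    minimum.\<close>
  define R where "R j k = (\<Prod>t\<in>S. \<alpha> t ^ (a j t - M j k t)) - (\<Prod>t\<in>S. \<alpha> t ^ (b k t - M j k t))" for j k
  define X where "X = I \<rightarrow>\<^sub>E S"
  define Y where "Y = J \<rightarrow>\<^sub>E S"
  define T where "T t = (\<Sum>j\<in>X. \<Sum>k\<in>Y. M j k t)" for t
  define u where "u = (\<Prod>j\<in>X. \<Prod>k\<in>Y. A j - B k)"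
  \<comment> \<open>The surplus \<open>T t - E\<close> of each root goes into the cofactor. The sign
    arises because \<open>coeff P 0\<close> is the product of the
    \<open>- \<alpha> t\<close>.\<close>
  define V where "V = (-1) ^ (card S * E) * ((\<Prod>t\<in>S. \<alpha> t ^ (T t - E)) * (\<Prod>j\<in>X. \<Prod>k\<in>Y. R j k))"
  have XY: "finite X" "finite Y"
    using fin by (auto simp: X_def Y_def finite_PiE)
  have ET: "E \<le> T t" if "t \<in> S" for t
    using E[OF that] by (simp add: T_def M_def a_def b_def X_def Y_def)
  have coeffs: "coeff (\<Prod>t\<in>S. [:- \<alpha> t, 1:]) i \<in> \<int>" for i
    unfolding P[symmetric] by (simp add: coeff_map_poly)
  have "of_int (coeff P 0) = poly (map_poly of_int P :: complex poly) 0"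
    by (simp add: poly_0_coeff_0 coeff_map_poly)
  then have a0: "of_int (coeff P 0) = (\<Prod>t\<in>S. - \<alpha> t)"
    unfolding P by (simp add: poly_prod)

  have alg: "algebraic_int (\<alpha> t)" if "t \<in> S" for t
  proof -
    have "lead_coeff (map_poly of_int P :: complex poly) = 1"
      unfolding P by (simp add: lead_coeff_prod)
    then have "lead_coeff P = 1"
      by (simp add: coeff_map_poly)
    moreover have "poly (map_poly of_int P) (\<alpha> t) = 0"
      unfolding P using that fin by (auto simp: poly_prod)
    ultimately show ?thesis
      unfolding algebraic_int_altdef_ipoly by auto
  qed
  have "algebraic_int V"
    unfolding V_def R_def
    by (intro algebraic_int_mult algebraic_int_prod algebraic_int_power algebraic_int_diff alg)
       (auto intro: int_imp_algebraic_int)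

  have factor: "A j - B k = (\<Prod>t\<in>S. \<alpha> t ^ M j k t) * R j k" if "j \<in> X" "k \<in> Y" for j k
  proof -
    have "A j = (\<Prod>t\<in>S. \<alpha> t ^ a j t)"
      unfolding A_def a_def using that fin by (intro prod_power_fibres) (auto simp: X_def)
    moreover have "B k = (\<Prod>t\<in>S. \<alpha> t ^ b k t)"
      unfolding B_def b_def using that fin by (intro prod_power_fibres) (auto simp: Y_def)
    ultimately show ?thesis
      by (simp add: R_def M_def right_diff_distrib flip: prod.distrib power_add)
  qed
  have "u = (\<Prod>j\<in>X. \<Prod>k\<in>Y. (\<Prod>t\<in>S. \<alpha> t ^ M j k t) * R j k)"
    unfolding u_def by (intro prod.cong refl factor)
  also have "\<dots> = (\<Prod>j\<in>X. \<Prod>k\<in>Y. \<Prod>t\<in>S. \<alpha> t ^ M j k t) * (\<Prod>j\<in>X. \<Prod>k\<in>Y. R j k)"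
    by (simp add: prod.distrib)
  also have "(\<Prod>j\<in>X. \<Prod>k\<in>Y. \<Prod>t\<in>S. \<alpha> t ^ M j k t) = (\<Prod>j\<in>X. \<Prod>t\<in>S. \<Prod>k\<in>Y. \<alpha> t ^ M j k t)"
    by (intro prod.cong refl prod.swap)
  also have "\<dots> = (\<Prod>t\<in>S. \<Prod>j\<in>X. \<Prod>k\<in>Y. \<alpha> t ^ M j k t)"
    by (rule prod.swap)
  also have "\<dots> = (\<Prod>t\<in>S. \<alpha> t ^ T t)"
    by (simp add: T_def power_sum)
  also have "\<dots> = (\<Prod>t\<in>S. \<alpha> t ^ E * \<alpha> t ^ (T t - E))"
    using ET by (intro prod.cong) (simp_all flip: power_add)
  also have "\<dots> = (\<Prod>t\<in>S. \<alpha> t) ^ E * (\<Prod>t\<in>S. \<alpha> t ^ (T t - E))"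
    by (simp add: prod.distrib prod_power_distrib)
  also have "(\<Prod>t\<in>S. \<alpha> t) ^ E = of_int (coeff P 0) ^ E * (-1) ^ (card S * E)"
    by (simp add: a0 prod_uminus power_mult_distrib flip: power_mult)
  finally have uV: "u = of_int (coeff P 0 ^ E) * V"
    by (simp add: V_def mult_ac)

  have power_sums: "(\<Sum>t\<in>S. \<alpha> t ^ m) \<in> \<int>" for m
    using power_sum_in_Ints[OF fin(1) coeffs] .
  have "(\<Sum>j\<in>X. A j ^ m) \<in> \<int>" for m
  proof -
    \<comment> \<open>Expanding the product on the right yields one summand per index tuple, so the
      power sum of the monomials is a product of power sums of the roots.\<close>
    have "(\<Sum>j\<in>X. A j ^ m) = (\<Prod>i\<in>I. \<Sum>t\<in>S. \<alpha> t ^ (w i * m))"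
      unfolding A_def X_def using fin by (simp add: prod_sum_PiE prod_power_distrib flip: power_mult)
    then show ?thesis using power_sums by (simp add: Ints_prod)
  qed
  moreover have "(\<Sum>k\<in>Y. B k ^ m) \<in> \<int>" for m
  proof -
    have "(\<Sum>k\<in>Y. B k ^ m) = (\<Prod>i\<in>J. \<Sum>t\<in>S. \<alpha> t ^ (w' i * m))"
      unfolding B_def Y_def using fin by (simp add: prod_sum_PiE prod_power_distrib flip: power_mult)
    then show ?thesis using power_sums by (simp add: Ints_prod)
  qed
  ultimately have "(\<Sum>z\<in>X \<times> Y. (case z of (j, k) \<Rightarrow> A j - B k) ^ m) \<in> \<int>" for m
    using sum_powers_of_differences_in_Ints[of A X B Y m]
    by (simp add: sum.cartesian_product case_prod_beta)
  then have "(\<Sum>z\<in>X \<times> Y. (case z of (j, k) \<Rightarrow> A j - B k) ^ m) \<in> \<rat>" for m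
    by (rule subsetD[OF Ints_subset_Rats])
  then have "(\<Prod>z\<in>X \<times> Y. case z of (j, k) \<Rightarrow> A j - B k) \<in> \<rat>"
    using XY by (intro prod_in_Rats_if_power_sums_in_Rats) auto
  then have "u \<in> \<rat>"
    by (simp add: u_def prod.cartesian_product)

  have "\<exists>v::int. u = of_int (coeff P 0 ^ E * v)"
  \<comment> \<open>In the zero case \<open>uV\<close> gives \<open>u = 0\<close>; otherwise
    \<open>V\<close> is a quotient of rational numbers.\<close>
  proof (cases "coeff P 0 ^ E = 0")
    case True
    then show ?thesis using uV by simp
  next
    case False
    then have "V = u / of_int (coeff P 0 ^ E)"
      using uV by simp
    then have "V \<in> \<rat>"
      using \<open>u \<in> \<rat>\<close> by simp
    then have "V \<in> \<int>"
      using rational_algebraic_int_is_int \<open>algebraic_int V\<close> by blast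
    then obtain v where "V = of_int v"
      by (auto elim: Ints_cases)
    then show ?thesis using uV by auto
  qed
  then show ?thesis
    unfolding u_def X_def Y_def A_def B_def by (metis dvd_triv_left)
qed

section \<open>The resultant as a product over pairs of index tuples\<close>

text \<open>The roots of \<open>root_prod_poly\<close>, with multiplicity, are the monomials of all
  index tuples. Tuples are indexed by positions in the sorted lists, as in the definition.\<close>

lemma U_conv_prod:
  fixes \<alpha> :: "nat \<Rightarrow> complex" and d n :: nat
  defines "ns \<equiv> sorted_list_of_multiset (mset_set (D_plus n))"
    and "ms \<equiv> sorted_list_of_multiset (mset_set (D_minus n))"
  shows "U \<alpha> d n = (\<Prod>j\<in>{..<length ns} \<rightarrow>\<^sub>E {1..d}. \<Prod>k\<in>{..<length ms} \<rightarrow>\<^sub>E {1..d}.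
    (\<Prod>i<length ns. \<alpha> (j i) ^ (ns ! i)) - (\<Prod>i<length ms. \<alpha> (k i) ^ (ms ! i)))"
proof -
  have roots: "proots (root_prod_poly \<alpha> d N) =
      image_mset (\<lambda>j. \<Prod>i<length xs. \<alpha> (j i) ^ (xs ! i)) (mset_set ({..<length xs} \<rightarrow>\<^sub>E {1..d}))"
    if "xs = sorted_list_of_multiset N" for N xs
    unfolding root_prod_poly_def that[symmetric] Let_def
    by (subst proots_prod) (auto simp: sum_unfold_sum_mset multiset.map_comp)
  show ?thesis
    unfolding U_def Res_def roots[OF ns_def[THEN meta_eq_to_obj_eq]] roots[OF ms_def[THEN meta_eq_to_obj_eq]]
    by (simp add: image_mset.compositionality o_def prod_unfold_prod_mset)
qed

section \<open>A lower bound for the difference of two products over primes\<close>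

text \<open>A single prime gives exactly 2. Inserting the largest element \<open>q\<close> last
  ensures \<open>q \<ge> 3\<close> from the second prime on, and
  \<open>(q + 1) * X - (q - 1) * Y = (q + 1) * (X - Y) + 2 * Y\<close> is then at least
  \<open>4 * (X - Y)\<close>.\<close>

lemma prod_Suc_minus_prod_pred_ge:
  fixes A :: "nat set"
  assumes "finite A" and "A \<noteq> {}" and "\<And>p. p \<in> A \<Longrightarrow> prime p"
  shows "2 * 4 ^ (card A - 1) \<le> (\<Prod>p\<in>A. int p + 1) - (\<Prod>p\<in>A. int p - 1)"
  using assms
proof (induction A rule: finite_linorder_max_induct)
  case (insert q A)
  show ?case
  proof (cases "A = {}")
    case False
    define X where "X = (\<Prod>p\<in>A. int p + 1)"
    define Y where "Y = (\<Prod>p\<in>A. int p - 1)"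
    obtain p where "p \<in> A" using False by blast
    then have "p < q" "p \<ge> 2"
      using insert by (auto intro: prime_ge_2_nat)
    then have q: "int q \<ge> 3" by simp
    have "Y \<ge> 0"
      unfolding Y_def using insert.prems by (intro prod_nonneg) (auto dest: prime_gt_0_nat)
    have IH: "2 * 4 ^ (card A - 1) \<le> X - Y"
      unfolding X_def Y_def using insert.IH False insert.prems by simp
    have "card A > 0" using False insert.hyps by (simp add: card_gt_0_iff)
    then have "2 * 4 ^ (card (insert q A) - 1) = 4 * (2 * 4 ^ (card A - 1) :: int)"
      using insert.hyps by (cases "card A") auto
    also have "\<dots> \<le> 4 * (X - Y)"
      using IH by simp
    also have "\<dots> \<le> (int q + 1) * (X - Y)"
    proof (rule mult_right_mono)
      show "0 \<le> X - Y" by (rule order_trans[OF _ IH]) simp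
    qed (use q in simp)
    also have "\<dots> \<le> (int q + 1) * X - (int q - 1) * Y"
      using \<open>Y \<ge> 0\<close> by (simp add: algebra_simps)
    finally show ?thesis
      using insert.hyps by (auto simp: X_def Y_def)
  qed simp
qed simp

section \<open>The sets \<open>D_plus n\<close> and \<open>D_minus n\<close> in terms of sets of
  primes\<close>

lemma prime_factors_prod_primes:
  fixes S :: "nat set"
  assumes "finite S" and "\<And>p. p \<in> S \<Longrightarrow> prime p"
  shows "prime_factors (\<Prod>S) = S"
proof -
  have "0 \<notin> S" using assms(2)[of 0] by auto
  then show ?thesis
    using assms by (subst prime_factors_prod) (auto simp: prime_prime_factors)
qed

lemma squarefree_prod_primes:
  fixes S :: "nat set"
  assumes "\<And>p. p \<in> S \<Longrightarrow> prime p"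
  shows "squarefree (\<Prod>S)"
  using assms by (intro squarefree_prod_coprime) (simp_all add: primes_coprime squarefree_prime)

lemma prod_prime_factors_squarefree:
  assumes "squarefree (q::nat)"
  shows "\<Prod>(prime_factors q) = q"
proof -
  have q: "q > 0" using assms by (auto intro: Nat.gr0I)
  have "q = (\<Prod>p\<in>prime_factors q. p ^ multiplicity p q)"
    using prime_factorization_nat[OF q] .
  also have "\<dots> = \<Prod>(prime_factors q)"
    using assms q by (intro prod.cong) (auto simp: squarefree_factorial_semiring' power_one_right)
  finally show ?thesis ..
qed

text \<open>The plain and the signed sum over all subsets will be expansions of products; together
  they determine the even and the odd part.\<close>

lemma sum_Pow_even_odd:
  fixes f :: "'a set \<Rightarrow> 'b::comm_ring_1"
  assumes "finite A"
  shows "(\<Sum>S | S \<subseteq> A \<and> even (card S). f S) + (\<Sum>S | S \<subseteq> A \<and> odd (card S). f S) = (\<Sum>S\<in>Pow A. f S)"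
    and "(\<Sum>S | S \<subseteq> A \<and> even (card S). f S) - (\<Sum>S | S \<subseteq> A \<and> odd (card S). f S)
      = (\<Sum>S\<in>Pow A. (-1) ^ card S * f S)"
proof -
  have *: "sum g (Pow A) = (\<Sum>S | S \<subseteq> A \<and> even (card S). g S) + (\<Sum>S | S \<subseteq> A \<and> odd (card S). g S)"
    for g :: "'a set \<Rightarrow> 'b"
    using assms by (subst sum.union_disjoint[symmetric]) (auto intro!: sum.cong)
  show "(\<Sum>S | S \<subseteq> A \<and> even (card S). f S) + (\<Sum>S | S \<subseteq> A \<and> odd (card S). f S) = (\<Sum>S\<in>Pow A. f S)"
    by (simp add: *)
  show "(\<Sum>S | S \<subseteq> A \<and> even (card S). f S) - (\<Sum>S | S \<subseteq> A \<and> odd (card S). f S)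
      = (\<Sum>S\<in>Pow A. (-1) ^ card S * f S)"
    by (simp add: * sum_negf)
qed

context
  fixes n :: nat
  assumes n: "n > 1"
begin

lemma prod_prime_factors_dvd:
  assumes "S \<subseteq> prime_factors n"
  shows "\<Prod>S dvd n"
proof -
  have "(\<Prod>p\<in>prime_factors n. p) dvd (\<Prod>p\<in>prime_factors n. p ^ multiplicity p n)"
    by (intro prod_dvd_prod) (auto simp: prime_factors_multiplicity intro: dvd_power)
  then have "\<Prod>(prime_factors n) dvd n"
    using prime_factorization_nat[of n] n by simp
  then show ?thesis
    using prod_dvd_prod_subset[OF _ assms, of "\<lambda>p. p"] dvd_trans by auto
qed

text \<open>A squarefree quotient \<open>n div m\<close> is the product of its set \<open>S\<close>
  of prime factors, and its sign is the parity of \<open>card S\<close>. The parameter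
  \<open>e\<close> treats both signs at once.\<close>

lemma moebius_eq_sign_iff:
  assumes "m dvd n" and "e = 0 \<or> e = (1::nat)"
  shows "moebius (n div m) = (-1) ^ e \<longleftrightarrow>
    (\<exists>S\<subseteq>prime_factors n. card S mod 2 = e \<and> m = n div \<Prod>S)"
proof
  assume "moebius (n div m) = (-1) ^ e"
  then have sf: "squarefree (n div m)" and c: "(-1) ^ card (prime_factors (n div m)) = (-1::int) ^ e"
    by (auto simp: moebius_def split: if_splits)
  have "prime_factors (n div m) \<subseteq> prime_factors n"
    using n assms(1) by (intro dvd_prime_factors) auto
  moreover have "card (prime_factors (n div m)) mod 2 = e"
    using c assms(2) by (auto simp: minus_one_power_iff mod_2_eq_odd split: if_splits)
  moreover have "m = n div (n div m)"
    using assms(1) n by (auto elim!: dvdE)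
  ultimately show "\<exists>S\<subseteq>prime_factors n. card S mod 2 = e \<and> m = n div \<Prod>S"
    using prod_prime_factors_squarefree[OF sf] by metis
next
  assume "\<exists>S\<subseteq>prime_factors n. card S mod 2 = e \<and> m = n div \<Prod>S"
  then obtain S where S: "S \<subseteq> prime_factors n" "card S mod 2 = e" "m = n div \<Prod>S"
    by blast
  have primes: "prime p" if "p \<in> S" for p
    using that S(1) by auto
  have "finite S"
    using S(1) finite_subset by blast
  have "n div m = \<Prod>S"
    using prod_prime_factors_dvd[OF S(1)] n unfolding S(3) by (auto elim!: dvdE)
  then have "moebius (n div m) = (-1) ^ card S"
    using squarefree_prod_primes[OF primes] prime_factors_prod_primes[OF \<open>finite S\<close> primes]
    by (simp add: moebius_def)
  then show "moebius (n div m) = (-1) ^ e"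
    using S(2) assms(2) by (auto simp: minus_one_power_iff mod_2_eq_odd)
qed

lemma D_plus_eq: "D_plus n = (\<lambda>S. n div \<Prod>S) ` {S. S \<subseteq> prime_factors n \<and> even (card S)}"
  and D_minus_eq: "D_minus n = (\<lambda>S. n div \<Prod>S) ` {S. S \<subseteq> prime_factors n \<and> odd (card S)}"
proof -
  have dvd: "n div \<Prod>S dvd n" if "S \<subseteq> prime_factors n" for S
    using prod_prime_factors_dvd[OF that] by (metis dvd_div_mult_self dvd_triv_left)
  have "m \<in> D_plus n \<longleftrightarrow> m \<in> (\<lambda>S. n div \<Prod>S) ` {S. S \<subseteq> prime_factors n \<and> even (card S)}"
    and "m \<in> D_minus n \<longleftrightarrow> m \<in> (\<lambda>S. n div \<Prod>S) ` {S. S \<subseteq> prime_factors n \<and> odd (card S)}" for m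
  proof -
    have "m \<in> D_plus n \<longleftrightarrow> m dvd n \<and> (\<exists>S\<subseteq>prime_factors n. even (card S) \<and> m = n div \<Prod>S)"
      using moebius_eq_sign_iff[of m 0] by (simp add: D_plus_def even_iff_mod_2_eq_zero cong: conj_cong)
    also have "\<dots> \<longleftrightarrow> m \<in> (\<lambda>S. n div \<Prod>S) ` {S. S \<subseteq> prime_factors n \<and> even (card S)}"
      using dvd by blast
    finally show "m \<in> D_plus n \<longleftrightarrow> m \<in> (\<lambda>S. n div \<Prod>S) ` {S. S \<subseteq> prime_factors n \<and> even (card S)}" .
    have "m \<in> D_minus n \<longleftrightarrow> m dvd n \<and> (\<exists>S\<subseteq>prime_factors n. odd (card S) \<and> m = n div \<Prod>S)"
      using moebius_eq_sign_iff[of m 1] by (simp add: D_minus_def odd_iff_mod_2_eq_one cong: conj_cong)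
    also have "\<dots> \<longleftrightarrow> m \<in> (\<lambda>S. n div \<Prod>S) ` {S. S \<subseteq> prime_factors n \<and> odd (card S)}"
      using dvd by blast
    finally show "m \<in> D_minus n \<longleftrightarrow> m \<in> (\<lambda>S. n div \<Prod>S) ` {S. S \<subseteq> prime_factors n \<and> odd (card S)}" .
  qed
  then show "D_plus n = (\<lambda>S. n div \<Prod>S) ` {S. S \<subseteq> prime_factors n \<and> even (card S)}"
    "D_minus n = (\<lambda>S. n div \<Prod>S) ` {S. S \<subseteq> prime_factors n \<and> odd (card S)}"
    by blast+
qed

text \<open>The quotient determines \<Prod>S, and unique factorisation recovers \<open>S\<close>
  from it.\<close>

lemma inj_on_div_prod: "inj_on (\<lambda>S. n div \<Prod>S) (Pow (prime_factors n))"
proof (rule inj_onI)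
  fix S T assume ST: "S \<in> Pow (prime_factors n)" "T \<in> Pow (prime_factors n)" "n div \<Prod>S = n div \<Prod>T"
  have "\<Prod>S * (n div \<Prod>S) = n" "\<Prod>T * (n div \<Prod>T) = n"
    using prod_prime_factors_dvd ST(1,2) by simp_all
  then have "\<Prod>S * (n div \<Prod>S) = \<Prod>T * (n div \<Prod>S)" "n div \<Prod>S \<noteq> 0"
    using n ST(3) by (simp, metis mult_0_right not_one_less_zero)
  then have "\<Prod>S = \<Prod>T"
    by (simp only: mult_cancel_right) simp
  moreover have "prime_factors (\<Prod>S) = S" "prime_factors (\<Prod>T) = T"
    using ST finite_subset[OF _ finite_set_mset] by (auto intro!: prime_factors_prod_primes)
  ultimately show "S = T" by metis
qed

lemma sum_D_plus: "sum f (D_plus n) = (\<Sum>S | S \<subseteq> prime_factors n \<and> even (card S). f (n div \<Prod>S))"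
  unfolding D_plus_eq by (subst sum.reindex) (auto intro: inj_on_subset[OF inj_on_div_prod])

lemma sum_D_minus: "sum f (D_minus n) = (\<Sum>S | S \<subseteq> prime_factors n \<and> odd (card S). f (n div \<Prod>S))"
  unfolding D_minus_eq by (subst sum.reindex) (auto intro: inj_on_subset[OF inj_on_div_prod])

lemma card_D:
  shows "card (D_plus n) = 2 ^ (card (prime_factors n) - 1)"
    and "card (D_minus n) = 2 ^ (card (prime_factors n) - 1)"
proof -
  let ?A = "prime_factors n"
  have "?A \<noteq> {}" using n by (auto simp: prime_factorization_empty_iff)
  then have "card ?A > 0" by (simp add: card_gt_0_iff)
  have "int (card (D_plus n)) = (\<Sum>S | S \<subseteq> ?A \<and> even (card S). 1)"
    "int (card (D_minus n)) = (\<Sum>S | S \<subseteq> ?A \<and> odd (card S). 1)"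
    using sum_D_plus[of "\<lambda>_. 1::int"] sum_D_minus[of "\<lambda>_. 1::int"] by simp_all
  \<comment> \<open>Expansion of the product of \<open>1 - 1\<close> over the nonempty set
    \<open>?A\<close>; it makes even and odd subsets equally numerous.\<close>
  moreover have "(\<Sum>S\<in>Pow ?A. (-1) ^ card S) = (0::int)"
    using prod_diff_conv_sum[of ?A "\<lambda>_. 1::int" "\<lambda>_. 1"] \<open>card ?A > 0\<close> by (simp add: zero_power)
  ultimately have "int (card (D_plus n)) + int (card (D_minus n)) = 2 ^ card ?A"
    "int (card (D_plus n)) - int (card (D_minus n)) = 0"
    using sum_Pow_even_odd[of ?A "\<lambda>_. 1::int"] by (simp_all add: card_Pow)
  moreover have "(2::int) ^ card ?A = 2 * 2 ^ (card ?A - 1)"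
    using \<open>card ?A > 0\<close> by (cases "card ?A") auto
  ultimately have "int (card (D_plus n)) = int (2 ^ (card ?A - 1))"
    "int (card (D_minus n)) = int (2 ^ (card ?A - 1))"
    by simp_all
  then show "card (D_plus n) = 2 ^ (card ?A - 1)" "card (D_minus n) = 2 ^ (card ?A - 1)"
    by (simp_all only: of_nat_eq_iff)
qed

lemma sum_D_ge:
  defines "n' \<equiv> \<Prod>p\<in>prime_factors n. p ^ (multiplicity p n - 1)"
  shows "n' * 4 ^ (card (prime_factors n) - 1) \<le> min (\<Sum>(D_plus n)) (\<Sum>(D_minus n))"
proof -
  let ?A = "prime_factors n"
  have "?A \<noteq> {}" using n by (auto simp: prime_factorization_empty_iff)
  have n_eq: "n = n' * \<Prod>?A"
  proof -
    have "n = (\<Prod>p\<in>?A. p ^ multiplicity p n)"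
      using prime_factorization_nat n by simp
    also have "\<dots> = (\<Prod>p\<in>?A. p ^ (multiplicity p n - 1) * p)"
      by (intro prod.cong) (auto simp: prime_factors_multiplicity simp flip: power_Suc2)
    finally show ?thesis by (simp add: n'_def prod.distrib)
  qed
  \<comment> \<open>Dividing out the primes in \<open>S\<close> leaves \<open>n'\<close> times the
    other primes, so sums over \<open>D_plus n\<close> and \<open>D_minus n\<close> become parts of
    the expansion of a product.\<close>
  have quot: "n div \<Prod>S = n' * \<Prod>(?A - S)" if "S \<subseteq> ?A" for S
  proof -
    have "\<Prod>?A = \<Prod>(?A - S) * \<Prod>S"
      using that by (intro prod.subset_diff) auto
    moreover have "\<Prod>S \<noteq> 0"
      using that by (auto simp: finite_subset)
    ultimately show ?thesis
      using n_eq by (metis mult.assoc nonzero_mult_div_cancel_right)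
  qed
  define F where "F S = int n' * (\<Prod>p\<in>?A - S. int p)" for S
  have "int (\<Sum>(D_plus n)) = (\<Sum>S | S \<subseteq> ?A \<and> even (card S). F S)"
    unfolding sum_D_plus by (auto simp: quot F_def intro!: sum.cong)
  moreover have "int (\<Sum>(D_minus n)) = (\<Sum>S | S \<subseteq> ?A \<and> odd (card S). F S)"
    unfolding sum_D_minus by (auto simp: quot F_def intro!: sum.cong)
  \<comment> \<open>In the expansion, \<open>S\<close> collects the primes whose factor contributes
    1; with -1 in its place the sign \<open>(-1) ^ card S\<close> appears.\<close>
  moreover have "(\<Sum>S\<in>Pow ?A. F S) = int n' * (\<Prod>p\<in>?A. int p + 1)"
    using prod_add[of ?A "\<lambda>_. 1" int] by (simp add: F_def sum_distrib_left add.commute)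
  moreover have "(\<Sum>S\<in>Pow ?A. (-1) ^ card S * F S) = int n' * (\<Prod>p\<in>?A. int p - 1)"
    using prod_diff_conv_sum[of ?A int "\<lambda>_. 1"] by (simp add: F_def sum_distrib_left mult_ac)
  ultimately have sums: "int (\<Sum>(D_plus n)) + int (\<Sum>(D_minus n)) = int n' * (\<Prod>p\<in>?A. int p + 1)"
    "int (\<Sum>(D_plus n)) - int (\<Sum>(D_minus n)) = int n' * (\<Prod>p\<in>?A. int p - 1)"
    using sum_Pow_even_odd[of ?A F] by simp_all
  \<comment> \<open>This makes the sum over \<open>D_minus n\<close> the minimum; it is half of
    \<open>n'\<close> times the difference of the two products.\<close>
  have "0 \<le> int n' * (\<Prod>p\<in>?A. int p - 1)"
    by (intro mult_nonneg_nonneg prod_nonneg) (auto simp: Suc_le_eq intro: prime_gt_0_nat)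
  then have le: "\<Sum>(D_minus n) \<le> \<Sum>(D_plus n)"
    using sums(2) by linarith
  have "int n' * (2 * 4 ^ (card ?A - 1)) \<le> int n' * ((\<Prod>p\<in>?A. int p + 1) - (\<Prod>p\<in>?A. int p - 1))"
    using \<open>?A \<noteq> {}\<close> by (intro mult_left_mono prod_Suc_minus_prod_pred_ge) auto
  also have "\<dots> = 2 * int (\<Sum>(D_minus n))"
    using sums by (simp add: right_diff_distrib)
  finally have "int n' * 4 ^ (card ?A - 1) \<le> int (\<Sum>(D_minus n))"
    by simp
  then have "int (n' * 4 ^ (card ?A - 1)) \<le> int (\<Sum>(D_minus n))"
    by simp
  then show ?thesis
    using le by (simp only: of_nat_le_iff min_absorb2)
qed

end

section \<open>The exponent bound for \<open>U\<close> and the resulting divisibility\<close>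

theorem theorem4p8:
  fixes P :: "int poly" and d n l n' :: nat and a\<^sub>0 :: int and \<alpha> :: "nat \<Rightarrow> complex"
  assumes "lead_coeff P = 1" and "irreducible P"
    and "d = degree P" and "a\<^sub>0 = coeff P 0"
    and roots: "map_poly of_int P = (\<Prod>i = 1..d. [:- \<alpha> i, 1:])"
    and "n > 1"
    and "l = card (prime_factors n)"
    and "n' = (\<Prod>p\<in>prime_factors n. p ^ (multiplicity p n - 1))"
  shows "\<exists>u::int. U \<alpha> d n = of_int u \<and>
           a\<^sub>0 ^ (n' * 2 ^ (2 * (l - 1)) * d ^ (2 ^ l - 2)) dvd u"
proof -
  define ns where "ns = sorted_list_of_multiset (mset_set (D_plus n))"
  define ms where "ms = sorted_list_of_multiset (mset_set (D_minus n))"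
  have mset: "mset ns = mset_set (D_plus n)" "mset ms = mset_set (D_minus n)"
    by (simp_all only: ns_def ms_def mset_sorted_list_of_multiset)
  have length: "length ns = 2 ^ (l - 1)" "length ms = 2 ^ (l - 1)"
    using card_D[OF \<open>n > 1\<close>] mset assms(7) by (simp_all flip: size_mset)
  have sums: "(\<Sum>i<length ns. ns ! i) = \<Sum>(D_plus n)" "(\<Sum>i<length ms. ms ! i) = \<Sum>(D_minus n)"
  proof -
    have "(\<Sum>i<length xs. xs ! i) = \<Sum>D" if "mset xs = mset_set D" for xs and D :: "nat set"
      unfolding sum_unfold_sum_mset[of "\<lambda>x. x" D] multiset.map_ident that[symmetric] sum_mset_sum_list
      by (simp add: sum_list_sum_nth atLeast0LessThan)
    then show "(\<Sum>i<length ns. ns ! i) = \<Sum>(D_plus n)" "(\<Sum>i<length ms. ms ! i) = \<Sum>(D_minus n)"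
      using mset by blast+
  qed
  have "prime_factors n \<noteq> {}"
    using \<open>n > 1\<close> by (auto simp: prime_factorization_empty_iff)
  then have "l > 0"
    using assms(7) by (simp add: card_gt_0_iff)
  \<comment> \<open>Fixing one position of a tuple of length \<open>2 ^ (l - 1)\<close> leaves
    \<open>2 ^ (l - 1) - 1\<close> free positions; both tuples together account for the exponent of
    \<open>d\<close>.\<close>
  then have exponent: "2 ^ l - 2 = (2 ^ (l - 1) - 1) + (2 ^ (l - 1) - 1 :: nat)"
    by (cases l) auto
  have "n' * 2 ^ (2 * (l - 1)) * d ^ (2 ^ l - 2) \<le>
      (\<Sum>j\<in>{..<length ns} \<rightarrow>\<^sub>E {1..d}. \<Sum>k\<in>{..<length ms} \<rightarrow>\<^sub>E {1..d}.
        min (\<Sum>i\<in>{i\<in>{..<length ns}. j i = t}. ns ! i) (\<Sum>i\<in>{i\<in>{..<length ms}. k i = t}. ms ! i))"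
    if "t \<in> {1..d}" for t
  proof -
    \<comment> \<open>The power \<open>2 ^ (2 * (l - 1))\<close> is the \<open>4 ^ (l - 1)\<close>
      of \<open>sum_D_ge\<close>.\<close>
    have "n' * 2 ^ (2 * (l - 1)) * d ^ (2 ^ l - 2) \<le>
        min (\<Sum>(D_plus n)) (\<Sum>(D_minus n)) * d ^ (2 ^ l - 2)"
      using sum_D_ge[OF \<open>n > 1\<close>] by (intro mult_right_mono) (simp_all add: assms(7,8) power_mult)
    also have "\<dots> = min (\<Sum>(D_plus n)) (\<Sum>(D_minus n)) *
        (card {1..d} ^ (card {..<length ns} - 1) * card {1..d} ^ (card {..<length ms} - 1))"
      by (simp only: exponent length power_add card_atLeastAtMost card_lessThan) simp
    \<comment> \<open>\<open>sum_min_ge\<close> is applied to the exponents of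
      \<open>\<alpha> t\<close>: each is a partial sum of the listed divisors, hence at most their
      full sum, and \<open>sum_fibre_weights\<close> supplies the totals.\<close>
    also have "\<dots> \<le> (\<Sum>j\<in>{..<length ns} \<rightarrow>\<^sub>E {1..d}. \<Sum>k\<in>{..<length ms} \<rightarrow>\<^sub>E {1..d}.
        min (\<Sum>i\<in>{i\<in>{..<length ns}. j i = t}. ns ! i) (\<Sum>i\<in>{i\<in>{..<length ms}. k i = t}. ms ! i))"
      unfolding sums[symmetric]
      by (intro sum_min_ge sum_fibre_weights sum_mono2 that) auto
    finally show ?thesis .
  qed
  then show ?thesis
    unfolding U_conv_prod ns_def[symmetric] ms_def[symmetric] assms(4)
    by (intro prod_differences_dvd) (use roots in auto)
qed

end
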